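(* Let $(X_k,\Phi_k)$ and $(Y_k,\Psi_k)$ be two $D$-chains. Then there is a common zig-zag $D$-chain of $(X_k,\Phi_k)$ and $(Y_k,\Psi_k)$ if and only if $end(X_k,\Phi_k)$ and $end(Y_k,\Psi_k)$ are all scale uniform equivalent.
   Context: All scale uniform: a map $f\colon X\to Y$ of metric spaces is all scale uniform if there is a non-decreasing function $\varrho\colon[0,\infty)\to[0,\infty)$ with $\varrho(0)=0$, $\lim_{t\to0}\varrho(t)=0$ and $\operatorname{diam}(f(A))\le\varrho(\operatorname{diam}(A))$ for every bounded $A\subset X$. $X$ and $Y$ are all scale uniform equivalent if there is a bijection $f\colon X\to Y$ with $f$ and $f^{-1}$ all scale uniform. $D$-chain: a family of sets $X_k$ ($k\in\mathbb Z$) and surjective maps $\Phi_k\colon X_k\to X_{k+1}$ whose direct limit is trivial (a single point); in particular, for all $x_i\in X_i$, $x_j\in X_j$ there is $k>i,j$ such that $x_i$ and $x_j$ have the same image in $X_k$. End space: $end(X_k,\Phi_k)=\{(x_k)_{k\in\mathbb Z}: x_k\in X_k,\ \Phi_k(x_k)=x_{k+1}\}$ with the ultrametric $D((x_k),(y_k))=2^{k_0}$, $k_0=\min\{k:x_k=y_k\}$, for distinct sequences, and $D=0$ for equal sequences. Subchain: for a (strictly) increasing $\alpha\colon\mathbb Z\to\mathbb Z$, the $\alpha$-subchain is $(X_{\alpha(k)},\tilde\Phi_k)$ with $\tilde\Phi_k=\Phi_{\alpha(k+1)-1}\circ\cdots\circ\Phi_{\alpha(k)}\colon X_{\alpha(k)}\to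 X_{\alpha(k+1)}$. Common zig-zag $D$-chain: a $D$-chain $(Z_k,\mathcal V_k)$ is a common zig-zag $D$-chain of $(X_k,\Phi_k)$ and $(Y_k,\Psi_k)$ if there are increasing maps $\alpha,\beta\colon\mathbb Z\to\mathbb Z$ such that $Z_{2k-1}=X_{\alpha(k)}$, $Z_{2k}=Y_{\beta(k)}$ for all $k$ (so $\mathcal V_{2k-1}\colon X_{\alpha(k)}\to Y_{\beta(k)}$ and $\mathcal V_{2k}\colon Y_{\beta(k)}\to X_{\alpha(k+1)}$), and $\mathcal V_{2k}\circ\mathcal V_{2k-1}=\tilde\Phi_k$, $\mathcal V_{2k+1}\circ\mathcal V_{2k}=\tilde\Psi_k$ for all $k$, where $(X_{\alpha(k)},\tilde\Phi_k)$ and $(Y_{\beta(k)},\tilde\Psi_k)$ are the corresponding subchains. *)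

theory Defs
  imports "HOL-Analysis.Analysis"
begin

section \<open>All scale uniform maps\<close>

text \<open>The counterpart of \<^const>\<open>diameter\<close> for an abstract metric space.\<close>

definition mdiameter :: "'a metric \<Rightarrow> 'a set \<Rightarrow> real" where
  "mdiameter m S = (if S = {} then 0 else SUP (x,y)\<in>S\<times>S. mdist m x y)"

text \<open>A real-valued supremum carries no information about unbounded sets, so the finiteness of
  the diameter of the image, which is part of the inequality between diameters, is a separate
  conjunct.\<close>

definition all_scale_uniform :: "'a metric \<Rightarrow> 'b metric \<Rightarrow> ('a \<Rightarrow> 'b) \<Rightarrow> bool" where
  "all_scale_uniform m1 m2 f \<longleftrightarrow>
     f \<in> mspace m1 \<rightarrow> mspace m2 \<and>
     (\<exists>\<rho> \<in> {0..} \<rightarrow> {0::real..}.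
        mono_on {0..} \<rho> \<and> \<rho> 0 = 0 \<and> (\<rho> \<longlongrightarrow> 0) (at_right 0) \<and>
        (\<forall>A. Metric_space.mbounded (mspace m1) (mdist m1) A \<longrightarrow>
             Metric_space.mbounded (mspace m2) (mdist m2) (f ` A) \<and>
             mdiameter m2 (f ` A) \<le> \<rho> (mdiameter m1 A)))"

definition all_scale_uniform_equivalent :: "'a metric \<Rightarrow> 'b metric \<Rightarrow> bool" where
  "all_scale_uniform_equivalent m1 m2 \<longleftrightarrow>
     (\<exists>f. bij_betw f (mspace m1) (mspace m2) \<and>
          all_scale_uniform m1 m2 f \<and>
          all_scale_uniform m2 m1 (inv_into (mspace m1) f))"

section \<open>D-chains\<close>

text \<open>The sets of a chain are subsets of one ambient type; this is no restriction, since any family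
  of sets embeds into its disjoint union.  The composite \<open>\<Phi> (j - 1) \<circ> \<dots> \<circ> \<Phi> i\<close>
  (the identity if \<open>j \<le> i\<close>) maps \<open>X i\<close> to \<open>X j\<close> if \<open>i \<le> j\<close>.\<close>

definition chain_comp :: "(int \<Rightarrow> 'a \<Rightarrow> 'a) \<Rightarrow> int \<Rightarrow> int \<Rightarrow> 'a \<Rightarrow> 'a" where
  "chain_comp \<Phi> i j = fold \<Phi> [i..j - 1]"

definition direct_limit_rel ::
    "(int \<Rightarrow> 'a set) \<Rightarrow> (int \<Rightarrow> 'a \<Rightarrow> 'a) \<Rightarrow> ((int \<times> 'a) \<times> (int \<times> 'a)) set" where
  "direct_limit_rel X \<Phi> =
     {((i, x), (j, y)) | i x j y. x \<in> X i \<and> y \<in> X j \<and>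
        (\<exists>k. i \<le> k \<and> j \<le> k \<and> chain_comp \<Phi> i k x = chain_comp \<Phi> j k y)}"

definition direct_limit :: "(int \<Rightarrow> 'a set) \<Rightarrow> (int \<Rightarrow> 'a \<Rightarrow> 'a) \<Rightarrow> (int \<times> 'a) set set" where
  "direct_limit X \<Phi> = Sigma UNIV X // direct_limit_rel X \<Phi>"

definition D_chain :: "(int \<Rightarrow> 'a set) \<Rightarrow> (int \<Rightarrow> 'a \<Rightarrow> 'a) \<Rightarrow> bool" where
  "D_chain X \<Phi> \<longleftrightarrow> (\<forall>k. \<Phi> k ` X k = X (k + 1)) \<and> is_singleton (direct_limit X \<Phi>)"

definition subchain_sets :: "(int \<Rightarrow> int) \<Rightarrow> (int \<Rightarrow> 'a set) \<Rightarrow> int \<Rightarrow> 'a set" where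
  "subchain_sets \<alpha> X k = X (\<alpha> k)"

definition subchain_maps :: "(int \<Rightarrow> int) \<Rightarrow> (int \<Rightarrow> 'a \<Rightarrow> 'a) \<Rightarrow> int \<Rightarrow> 'a \<Rightarrow> 'a" where
  "subchain_maps \<alpha> \<Phi> k = chain_comp \<Phi> (\<alpha> k) (\<alpha> (k + 1))"

text \<open>The sets of the zig-zag chain come alternately from the two given chains, hence it lives in
  the sum of the two ambient types, and \<open>X (\<alpha> k)\<close> and \<open>Y (\<beta> k)\<close> are identified with their
  images under \<^const>\<open>Inl\<close> and \<^const>\<open>Inr\<close>.\<close>

definition common_zigzag_D_chain ::
    "(int \<Rightarrow> 'a set) \<Rightarrow> (int \<Rightarrow> 'a \<Rightarrow> 'a) \<Rightarrow> (int \<Rightarrow> 'b set) \<Rightarrow> (int \<Rightarrow> 'b \<Rightarrow> 'b) \<Rightarrow>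
     (int \<Rightarrow> ('a + 'b) set) \<Rightarrow> (int \<Rightarrow> 'a + 'b \<Rightarrow> 'a + 'b) \<Rightarrow> bool" where
  "common_zigzag_D_chain X \<Phi> Y \<Psi> Z V \<longleftrightarrow>
     D_chain Z V \<and>
     (\<exists>\<alpha> \<beta>. strict_mono \<alpha> \<and> strict_mono \<beta> \<and>
        (\<forall>k. Z (2 * k - 1) = Inl ` subchain_sets \<alpha> X k \<and>
             Z (2 * k) = Inr ` subchain_sets \<beta> Y k \<and>
             (\<forall>x \<in> subchain_sets \<alpha> X k.
                V (2 * k) (V (2 * k - 1) (Inl x)) = Inl (subchain_maps \<alpha> \<Phi> k x)) \<and>
             (\<forall>y \<in> subchain_sets \<beta> Y k.
                V (2 * k + 1) (V (2 * k) (Inr y)) = Inr (subchain_maps \<beta> \<Psi> k y))))"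

section \<open>The end space\<close>

definition end_space :: "(int \<Rightarrow> 'a set) \<Rightarrow> (int \<Rightarrow> 'a \<Rightarrow> 'a) \<Rightarrow> (int \<Rightarrow> 'a) set" where
  "end_space X \<Phi> = {x. \<forall>k. x k \<in> X k \<and> \<Phi> k (x k) = x (k + 1)}"

definition end_dist :: "(int \<Rightarrow> 'a) \<Rightarrow> (int \<Rightarrow> 'a) \<Rightarrow> real" where
  "end_dist x y = (if x = y then 0 else 2 powi (LEAST k. x k = y k))"

definition end_metric :: "(int \<Rightarrow> 'a set) \<Rightarrow> (int \<Rightarrow> 'a \<Rightarrow> 'a) \<Rightarrow> (int \<Rightarrow> 'a) metric" where
  "end_metric X \<Phi> = metric (end_space X \<Phi>, end_dist)"

text \<open>The remaining lemmas show that, for a D-chain, the minimum in \<^const>\<open>end_dist\<close> is attained and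
  \<^const>\<open>end_metric\<close> is the intended (ultra)metric space.\<close>

lemma chain_comp_refl [simp]: "chain_comp \<Phi> i i = id"
  by (simp add: chain_comp_def)

lemma chain_comp_step: "i \<le> j \<Longrightarrow> chain_comp \<Phi> i (j + 1) x = \<Phi> j (chain_comp \<Phi> i j x)"
  by (simp add: chain_comp_def upto_rec2)

lemma chain_comp_trans:
  assumes "i \<le> j" "j \<le> k"
  shows "chain_comp \<Phi> i k x = chain_comp \<Phi> j k (chain_comp \<Phi> i j x)"
  using assms(2)
proof (induction k rule: int_ge_induct)
  case (step k)
  then show ?case using assms(1) by (simp add: chain_comp_step)
qed simp

lemma equiv_direct_limit_rel: "equiv (Sigma UNIV X) (direct_limit_rel X \<Phi>)"
proof (rule equivI)
  show "direct_limit_rel X \<Phi> \<subseteq> Sigma UNIV X \<times> Sigma UNIV X"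
    by (auto simp: direct_limit_rel_def)
  show "refl_on (Sigma UNIV X) (direct_limit_rel X \<Phi>)"
    by (auto simp: direct_limit_rel_def refl_on_def)
  show "sym (direct_limit_rel X \<Phi>)"
    by (rule symI) (auto simp: direct_limit_rel_def, metis)
  show "trans (direct_limit_rel X \<Phi>)"
  proof (rule transI, clarsimp simp: direct_limit_rel_def)
    fix i x j y l z k k'
    assume k: "i \<le> k" "j \<le> k" "chain_comp \<Phi> i k x = chain_comp \<Phi> j k y"
      and k': "j \<le> k'" "l \<le> k'" "chain_comp \<Phi> j k' y = chain_comp \<Phi> l k' z"
    have "chain_comp \<Phi> i (max k k') x = chain_comp \<Phi> l (max k k') z"
      using k k' by (metis chain_comp_trans max.cobounded1 max.cobounded2)
    then show "\<exists>m\<ge>i. l \<le> m \<and> chain_comp \<Phi> i m x = chain_comp \<Phi> l m z"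
      using k k' by (meson max.coboundedI1 max.coboundedI2)
  qed
qed

lemma D_chain_merge:
  assumes "D_chain X \<Phi>" "x \<in> X i" "y \<in> X j"
  shows "\<exists>k. i < k \<and> j < k \<and> chain_comp \<Phi> i k x = chain_comp \<Phi> j k y"
proof -
  let ?R = "direct_limit_rel X \<Phi>"
  obtain p where p: "direct_limit X \<Phi> = {p}"
    using assms(1) by (auto simp: D_chain_def is_singleton_def)
  have "?R `` {(i, x)} \<in> direct_limit X \<Phi>" "?R `` {(j, y)} \<in> direct_limit X \<Phi>"
    using assms by (auto simp: direct_limit_def intro!: quotientI)
  then have "?R `` {(i, x)} = ?R `` {(j, y)}" using p by simp
  then have "((i, x), (j, y)) \<in> ?R"
    using eq_equiv_class[OF _ equiv_direct_limit_rel[of X \<Phi>]] assms(3) by blast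
  then obtain k where k: "i \<le> k" "j \<le> k" "chain_comp \<Phi> i k x = chain_comp \<Phi> j k y"
    by (auto simp: direct_limit_rel_def)
  then show ?thesis
    by (intro exI[of _ "k + 1"]) (auto simp: chain_comp_step)
qed

lemma end_space_chain_comp:
  assumes "x \<in> end_space X \<Phi>" "i \<le> j"
  shows "chain_comp \<Phi> i j (x i) = x j"
  using assms(2)
proof (induction j rule: int_ge_induct)
  case (step j)
  then show ?case using assms(1) by (simp add: chain_comp_step end_space_def)
qed simp

lemma end_Least_iff:
  assumes "D_chain X \<Phi>" "x \<in> end_space X \<Phi>" "y \<in> end_space X \<Phi>" "x \<noteq> y"
  shows "x k = y k \<longleftrightarrow> (LEAST k. x k = y k) \<le> k"
proof -
  have up: "x j = y j" if "x i = y i" "i \<le> j" for i j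
    using that assms(2,3) by (metis end_space_chain_comp)
  obtain a where a: "x a \<noteq> y a" using assms(4) by blast
  obtain b where b: "a < b" "x b = y b"
    using D_chain_merge[OF assms(1), of "x a" a "y a" a] assms(2,3)
    by (metis (mono_tags, lifting) end_space_chain_comp end_space_def less_imp_le mem_Collect_eq)
  define n where "n = (LEAST n. x (a + int n) = y (a + int n))"
  have n: "x (a + int n) = y (a + int n)"
    unfolding n_def by (rule LeastI[of _ "nat (b - a)"]) (use b in simp)
  have least: "a + int n \<le> c" if "x c = y c" for c
  proof -
    have "a \<le> c" using up[OF that, of a] a by linarith
    then have "n \<le> nat (c - a)"
      unfolding n_def by (intro Least_le) (use that in simp)
    then show ?thesis using \<open>a \<le> c\<close> by linarith
  qed
  have "(LEAST k. x k = y k) = a + int n"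
    by (rule Least_equality) (use n least in auto)
  then show ?thesis using n least up by metis
qed

lemma end_dist_le_iff:
  assumes "D_chain X \<Phi>" "x \<in> end_space X \<Phi>" "y \<in> end_space X \<Phi>"
  shows "end_dist x y \<le> 2 powi k \<longleftrightarrow> x k = y k"
proof (cases "x = y")
  case False
  have "(2::real) powi m \<le> 2 powi k \<longleftrightarrow> m \<le> k" for m
    using power_int_increasing[of m k "2::real"] power_int_strict_increasing[of k m "2::real"]
    by (cases "m \<le> k") auto
  then show ?thesis using False end_Least_iff[OF assms False, of k] by (simp add: end_dist_def)
qed (simp add: end_dist_def)

lemma end_dist_ultra:
  assumes "D_chain X \<Phi>" "x \<in> end_space X \<Phi>" "y \<in> end_space X \<Phi>" "z \<in> end_space X \<Phi>"
  shows "end_dist x z \<le> max (end_dist x y) (end_dist y z)"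
proof (cases "x = y \<or> y = z")
  case False
  define i j where "i = (LEAST k. x k = y k)" and "j = (LEAST k. y k = z k)"
  have "x (max i j) = z (max i j)"
    using False end_Least_iff[OF assms(1,2,3), of "max i j"]
      end_Least_iff[OF assms(1,3,4), of "max i j"]
    by (simp add: i_def j_def)
  then have "end_dist x z \<le> 2 powi (max i j)"
    by (simp add: end_dist_le_iff[OF assms(1,2,4)])
  also have "\<dots> \<le> max (2 powi i) (2 powi j)" by (simp add: max_def)
  also have "\<dots> = max (end_dist x y) (end_dist y z)"
    using False by (simp add: end_dist_def i_def j_def)
  finally show ?thesis .
qed (auto simp: end_dist_def)

lemma Metric_space_end:
  assumes "D_chain X \<Phi>"
  shows "Metric_space (end_space X \<Phi>) end_dist"
proof
  fix x y z :: "int \<Rightarrow> 'a"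
  show nn: "0 \<le> end_dist x y" for x y :: "int \<Rightarrow> 'a" by (simp add: end_dist_def)
  have "(\<lambda>k. x k = y k) = (\<lambda>k. y k = x k)" by auto
  then show "end_dist x y = end_dist y x" by (simp add: end_dist_def)
  show "end_dist x y = 0 \<longleftrightarrow> x = y" by (simp add: end_dist_def)
  show "end_dist x z \<le> end_dist x y + end_dist y z"
    if "x \<in> end_space X \<Phi>" "y \<in> end_space X \<Phi>" "z \<in> end_space X \<Phi>"
    using end_dist_ultra[OF assms that] nn[of x y] nn[of y z] by linarith
qed

lemma end_metric_simps:
  assumes "D_chain X \<Phi>"
  shows "mspace (end_metric X \<Phi>) = end_space X \<Phi>" "mdist (end_metric X \<Phi>) = end_dist"
  using Metric_space.mspace_metric[OF Metric_space_end[OF assms]]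
    Metric_space.mdist_metric[OF Metric_space_end[OF assms]]
  by (simp_all add: end_metric_def)

end

theory Submission
  imports Defs
begin

text \<open>
  In an end space, \<open>end_dist x y \<le> 2 powi k\<close> means \<open>x k = y k\<close>, so metric conditions become
  conditions on levels.  Call \<open>j\<close> controlled by \<open>i\<close> under \<open>f\<close> if \<open>f x\<close> at level \<open>j\<close> depends only
  on \<open>x\<close> at level \<open>i\<close> (\<open>level_control\<close>).  An all scale uniform map is one that is controlled at
  large scales (every \<open>i\<close> controls some \<open>j\<close>) and uniformly continuous (every \<open>j\<close> is controlled by
  some \<open>i\<close>); this is \<open>all_scale_uniform_end_iff\<close>, a consequence of the corresponding description
  \<open>all_scale_uniform_iff\<close> in arbitrary metric spaces.

  A common zig-zag chain consists of maps \<open>X (\<alpha> k) \<rightarrow> Y (\<beta> k)\<close> and \<open>Y (\<beta> k) \<rightarrow> X (\<alpha> (k + 1))\<close> that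
  commute with the bonding maps.  Since \<open>\<alpha>\<close> and \<open>\<beta>\<close> are unbounded in both directions, an end is
  determined by its coordinates along such a sequence, and every coherent choice of these
  coordinates extends to an end (\<open>end_space_through_cofinal\<close>).  Thus the two families of maps induce
  maps \<open>f\<close> and \<open>g\<close> of the end spaces; the zig-zag equations make them inverse to each other, and by
  construction \<open>\<alpha> k\<close> controls \<open>\<beta> k\<close> under \<open>f\<close> and \<open>\<beta> k\<close> controls \<open>\<alpha> (k + 1)\<close> under \<open>g\<close>.

  Conversely, given an equivalence \<open>f\<close>, every level controls some higher level under both \<open>f\<close> and
  its inverse, and every level is so controlled by a lower one.  Choosing upwards and downwards
  from an arbitrary start gives a strictly increasing sequence \<open>\<gamma>\<close> in which each term controls the
  next under both maps (\<open>ex_interleaved_control\<close>).  Now take \<open>X (\<gamma> n)\<close> for odd \<open>n\<close> and \<open>Y (\<gamma> n)\<close>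
  for even \<open>n\<close>.  Every element of these sets is the trace at stage \<open>n\<close> of an end \<open>x\<close>, namely
  \<open>x (\<gamma> n)\<close> or \<open>f x (\<gamma> n)\<close>.  Control says precisely that the trace of \<open>x\<close> at stage \<open>n\<close> determines
  its trace at stage \<open>n + 1\<close>, and this assignment is the connecting map of the zig-zag chain.
\<close>

section \<open>All scale uniform maps of metric spaces\<close>

lemma mdist_le_mdiameter:
  assumes "Metric_space.mbounded (mspace m) (mdist m) A" "x \<in> A" "y \<in> A"
  shows "mdist m x y \<le> mdiameter m A"
proof -
  interpret Metric_space "mspace m" "mdist m" by simp
  obtain B where "\<forall>x \<in> A. \<forall>y \<in> A. mdist m x y \<le> B"
    using assms(1) by (auto simp: mbounded_alt)
  then have "bdd_above ((\<lambda>(x, y). mdist m x y) ` (A \<times> A))"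
    by (intro bdd_aboveI[of _ B]) auto
  from cSUP_upper[OF _ this, of "(x, y)"] show ?thesis
    using assms(2,3) by (auto simp: mdiameter_def)
qed

lemma mdiameter_le:
  assumes "\<And>x y. x \<in> A \<Longrightarrow> y \<in> A \<Longrightarrow> mdist m x y \<le> b" "0 \<le> b"
  shows "mdiameter m A \<le> b"
  unfolding mdiameter_def using assms by (auto intro!: cSUP_least)

lemma mdiameter_doubleton_le:
  assumes "x \<in> mspace m" "y \<in> mspace m"
  shows "mdiameter m {x, y} \<le> mdist m x y"
proof -
  have "mdist m x x = 0" "mdist m y y = 0" using assms by auto
  then show ?thesis by (intro mdiameter_le) (auto simp: mdist_commute)
qed

text \<open>All scale uniform maps are those that are both bornologous and uniformly continuous.  A diameter
  is a supremum of distances, so only pairs of points matter.  For the converse, the modulus \<open>\<rho> r\<close>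
  is the supremum of the distances of images of points at distance at most \<open>r\<close>: it is finite by the
  first condition and tends to \<open>0\<close> at \<open>0\<close> by the second.\<close>

lemma all_scale_uniform_iff:
  "all_scale_uniform m1 m2 f \<longleftrightarrow> f \<in> mspace m1 \<rightarrow> mspace m2 \<and>
     (\<forall>r. \<exists>s. \<forall>x \<in> mspace m1. \<forall>y \<in> mspace m1.
        mdist m1 x y \<le> r \<longrightarrow> mdist m2 (f x) (f y) \<le> s) \<and>
     (\<forall>e > 0. \<exists>d > 0. \<forall>x \<in> mspace m1. \<forall>y \<in> mspace m1.
        mdist m1 x y \<le> d \<longrightarrow> mdist m2 (f x) (f y) \<le> e)"
  (is "?L \<longleftrightarrow> ?F \<and> ?C \<and> ?U")
proof
  assume ?L
  then have F: ?F by (simp add: all_scale_uniform_def)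
  from \<open>?L\<close> obtain \<rho> where \<rho>: "mono_on {0..} \<rho>" "(\<rho> \<longlongrightarrow> (0::real)) (at_right 0)"
    and diam: "\<And>A. Metric_space.mbounded (mspace m1) (mdist m1) A \<Longrightarrow>
             Metric_space.mbounded (mspace m2) (mdist m2) (f ` A) \<and>
             mdiameter m2 (f ` A) \<le> \<rho> (mdiameter m1 A)"
    by (auto simp: all_scale_uniform_def)
  have le: "mdist m2 (f x) (f y) \<le> \<rho> r"
    if xy: "x \<in> mspace m1" "y \<in> mspace m1" "mdist m1 x y \<le> r" for x y r
  proof -
    interpret Metric_space "mspace m1" "mdist m1" by simp
    have b: "mbounded {x, y}" using xy unfolding mbounded_alt
      by (intro conjI exI[of _ "mdist m1 x y"]) (auto simp: commute)
    have "0 \<le> mdiameter m1 {x, y}" using mdist_le_mdiameter[OF b, of x x] xy by simp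
    moreover have "mdiameter m1 {x, y} \<le> r" using mdiameter_doubleton_le[OF xy(1,2)] xy(3) by simp
    ultimately have "\<rho> (mdiameter m1 {x, y}) \<le> \<rho> r"
      by (intro mono_onD[OF \<rho>(1)]) auto
    moreover have "mdist m2 (f x) (f y) \<le> mdiameter m2 (f ` {x, y})"
      using diam[OF b] by (intro mdist_le_mdiameter) auto
    ultimately show ?thesis using diam[OF b] by linarith
  qed
  have ?U
  proof (intro allI impI)
    fix e :: real assume "0 < e"
    then have "\<forall>\<^sub>F t in at_right 0. \<rho> t < e"
      using order_tendstoD(2)[OF \<rho>(2)] by blast
    then obtain b where b: "b > 0" "\<And>t. 0 < t \<Longrightarrow> t < b \<Longrightarrow> \<rho> t < e"
      by (auto simp: eventually_at_right_field)
    have "\<rho> (b / 2) \<le> e" using b by (intro less_imp_le) simp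
    then show "\<exists>d > 0. \<forall>x \<in> mspace m1. \<forall>y \<in> mspace m1.
        mdist m1 x y \<le> d \<longrightarrow> mdist m2 (f x) (f y) \<le> e"
      using le b(1) by (intro exI[of _ "b / 2"]) (metis half_gt_zero order_trans)
  qed
  then show "?F \<and> ?C \<and> ?U" using F le by blast
next
  assume "?F \<and> ?C \<and> ?U"
  then have F: ?F and C: ?C and U: ?U by auto
  \<comment> \<open>Inserting \<open>0\<close> keeps the supremum meaningful when no pair of points is that close.\<close>
  define S where "S r = insert 0 {mdist m2 (f x) (f y) | x y.
     x \<in> mspace m1 \<and> y \<in> mspace m1 \<and> mdist m1 x y \<le> r}" for r
  have bdd: "bdd_above (S r)" for r
  proof -
    obtain s where "\<forall>x \<in> mspace m1. \<forall>y \<in> mspace m1.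
        mdist m1 x y \<le> r \<longrightarrow> mdist m2 (f x) (f y) \<le> s" using C by blast
    then show ?thesis by (intro bdd_aboveI[of _ "max 0 s"]) (auto simp: S_def le_max_iff_disj)
  qed
  define \<rho> where "\<rho> r = Sup (S r)" for r
  have ne: "S r \<noteq> {}" for r by (simp add: S_def)
  have nonneg: "0 \<le> \<rho> r" for r
    unfolding \<rho>_def by (rule cSup_upper[OF _ bdd]) (simp add: S_def)
  have dist: "mdist m2 (f x) (f y) \<le> \<rho> r"
    if "x \<in> mspace m1" "y \<in> mspace m1" "mdist m1 x y \<le> r" for x y r
    unfolding \<rho>_def by (rule cSup_upper[OF _ bdd]) (use that in \<open>auto simp: S_def\<close>)
  have mono: "\<rho> r \<le> \<rho> s" if "r \<le> s" for r s
  proof -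
    have "S r \<subseteq> S s"
      using order_trans[OF _ that] unfolding S_def by blast
    then show ?thesis unfolding \<rho>_def by (rule cSup_subset_mono[OF ne bdd])
  qed
  have "mdist m2 (f x) (f y) = 0" if "x \<in> mspace m1" "y \<in> mspace m1" "mdist m1 x y \<le> 0" for x y
  proof -
    have "mdist m1 x y = 0" using that(3) mdist_nonneg[of m1 x y] by linarith
    then have "x = y" using that by simp
    moreover have "f x \<in> mspace m2" using F that(1) by blast
    ultimately show ?thesis by simp
  qed
  then have "S 0 = {0}" by (auto simp: S_def)
  then have zero: "\<rho> 0 = 0" by (simp add: \<rho>_def)
  have lim: "(\<rho> \<longlongrightarrow> 0) (at_right 0)"
  proof (rule order_tendstoI)
    fix e :: real assume e: "0 < e"
    then obtain d where d: "d > 0" "\<forall>x \<in> mspace m1. \<forall>y \<in> mspace m1.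
        mdist m1 x y \<le> d \<longrightarrow> mdist m2 (f x) (f y) \<le> e / 2"
      using U half_gt_zero by blast
    have "\<rho> d \<le> e / 2"
      unfolding \<rho>_def by (rule cSup_least[OF ne]) (use d(2) e in \<open>auto simp: S_def\<close>)
    then have "\<rho> t < e" if "t < d" for t using mono[of t d] that e by linarith
    then show "\<forall>\<^sub>F t in at_right 0. \<rho> t < e"
      using d(1) by (auto simp: eventually_at_right_field)
  next
    fix e :: real assume "e < 0"
    then have "e < \<rho> t" for t using nonneg[of t] by linarith
    then show "\<forall>\<^sub>F t in at_right 0. e < \<rho> t" by simp
  qed
  have diam: "Metric_space.mbounded (mspace m2) (mdist m2) (f ` A) \<and>
      mdiameter m2 (f ` A) \<le> \<rho> (mdiameter m1 A)"
    if A: "Metric_space.mbounded (mspace m1) (mdist m1) A" for A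
  proof -
    interpret m1: Metric_space "mspace m1" "mdist m1" by simp
    interpret m2: Metric_space "mspace m2" "mdist m2" by simp
    have sub: "A \<subseteq> mspace m1" using A by (simp add: m1.mbounded_alt)
    have *: "mdist m2 (f x) (f y) \<le> \<rho> (mdiameter m1 A)" if "x \<in> A" "y \<in> A" for x y
      using that sub mdist_le_mdiameter[OF A that] by (intro dist) auto
    then have "m2.mbounded (f ` A)" using F sub by (auto simp: m2.mbounded_alt)
    moreover have "mdiameter m2 (f ` A) \<le> \<rho> (mdiameter m1 A)"
      using * nonneg by (intro mdiameter_le) auto
    ultimately show ?thesis by blast
  qed
  have "\<rho> \<in> {0..} \<rightarrow> {0..}" using nonneg by simp
  moreover have "mono_on {0..} \<rho>" using mono by (rule mono_onI)
  ultimately show ?L unfolding all_scale_uniform_def using F zero lim diam by blast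
qed

section \<open>Maps of end spaces\<close>

text \<open>On ends of D-chains this says that \<open>end_dist x y \<le> 2 powi i\<close> implies
  \<open>end_dist (f x) (f y) \<le> 2 powi j\<close>.\<close>

definition level_control ::
    "(int \<Rightarrow> 'a) set \<Rightarrow> ((int \<Rightarrow> 'a) \<Rightarrow> (int \<Rightarrow> 'b)) \<Rightarrow> int \<Rightarrow> int \<Rightarrow> bool" where
  "level_control E f i j \<longleftrightarrow> (\<forall>x \<in> E. \<forall>y \<in> E. x i = y i \<longrightarrow> f x j = f y j)"

lemma ex_powi_two_ge: "\<exists>k. (r::real) \<le> 2 powi k"
proof -
  obtain n where "r < 2 ^ n" using real_arch_pow[of 2 r] by auto
  then show ?thesis by (intro exI[of _ "int n"]) simp
qed

lemma ex_powi_two_le: "\<exists>k. 2 powi k \<le> r" if "0 < (r::real)"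
proof -
  obtain k where "inverse r \<le> 2 powi k" using ex_powi_two_ge by blast
  then have "2 powi (- k) \<le> r"
    using le_imp_inverse_le[of "inverse r" "2 powi k"] that by (simp add: power_int_minus)
  then show ?thesis by blast
qed

text \<open>The powers of \<open>2\<close> are cofinal in the positive reals in both directions, so the two metric
  conditions can be tested on them, where they speak of levels.\<close>

lemma all_scale_uniform_end_iff:
  assumes X: "D_chain X \<Phi>" and Y: "D_chain Y \<Psi>"
  shows "all_scale_uniform (end_metric X \<Phi>) (end_metric Y \<Psi>) f \<longleftrightarrow>
     f \<in> end_space X \<Phi> \<rightarrow> end_space Y \<Psi> \<and>
     (\<forall>i. \<exists>j. level_control (end_space X \<Phi>) f i j) \<and>
     (\<forall>j. \<exists>i. level_control (end_space X \<Phi>) f i j)"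
proof (cases "f \<in> end_space X \<Phi> \<rightarrow> end_space Y \<Psi>")
  case True
  let ?E = "end_space X \<Phi>"
  define W where "W r s \<longleftrightarrow>
    (\<forall>x \<in> ?E. \<forall>y \<in> ?E. end_dist x y \<le> r \<longrightarrow> end_dist (f x) (f y) \<le> s)" for r s
  have lc: "level_control ?E f i j \<longleftrightarrow> W (2 powi i) (2 powi j)" for i j
    unfolding level_control_def W_def using True
    by (auto simp: end_dist_le_iff[OF X] end_dist_le_iff[OF Y] Pi_iff)
  have W: "W r' s'" if "W r s" "r' \<le> r" "s \<le> s'" for r r' s s'
    using that unfolding W_def by (meson order_trans)
  have "(\<forall>i. \<exists>j. level_control ?E f i j) \<longleftrightarrow> (\<forall>r. \<exists>s. W r s)"
    unfolding lc by (metis W ex_powi_two_ge order_refl)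
  moreover have "(\<forall>j. \<exists>i. level_control ?E f i j) \<longleftrightarrow> (\<forall>e > 0. \<exists>d > 0. W d e)"
    unfolding lc
  proof (intro iffI allI impI)
    fix e :: real assume *: "\<forall>j. \<exists>i. W (2 powi i) (2 powi j)" and "0 < e"
    then obtain j where "2 powi j \<le> e" using ex_powi_two_le by blast
    moreover obtain i where "W (2 powi i) (2 powi j)" using * by blast
    ultimately have "W (2 powi i) e" using W by blast
    then show "\<exists>d > 0. W d e" by (intro exI[of _ "2 powi i"]) simp
  next
    fix j :: int assume "\<forall>e > 0. \<exists>d > 0. W d e"
    then obtain d where d: "0 < d" "W d (2 powi j)" by (metis zero_less_power_int zero_less_numeral)
    then obtain i where "2 powi i \<le> d" using ex_powi_two_le by blast
    then show "\<exists>i. W (2 powi i) (2 powi j)" using d W by blast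
  qed
  ultimately show ?thesis
    using True unfolding W_def by (simp add: all_scale_uniform_iff end_metric_simps[OF X] end_metric_simps[OF Y])
qed (simp add: all_scale_uniform_def end_metric_simps[OF X] end_metric_simps[OF Y])

lemma level_control_mono:
  assumes "level_control (end_space X \<Phi>) f i j" "f \<in> end_space X \<Phi> \<rightarrow> end_space Y \<Psi>"
    and "i' \<le> i" "j \<le> j'"
  shows "level_control (end_space X \<Phi>) f i' j'"
  unfolding level_control_def
proof (intro ballI impI)
  fix x y assume xy: "x \<in> end_space X \<Phi>" "y \<in> end_space X \<Phi>" "x i' = y i'"
  then have "x i = y i" using assms(3) by (metis end_space_chain_comp)
  then have "f x j = f y j" using assms(1) xy(1,2) unfolding level_control_def by blast
  moreover have "f x \<in> end_space Y \<Psi>" "f y \<in> end_space Y \<Psi>" using assms(2) xy by auto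
  ultimately show "f x j' = f y j'" using assms(4) by (metis end_space_chain_comp)
qed

lemma chain_comp_in:
  assumes "\<And>k. \<Phi> k ` X k \<subseteq> X (k + 1)" "a \<in> X i" "i \<le> j"
  shows "chain_comp \<Phi> i j a \<in> X j"
  using assms(3)
proof (induction j rule: int_ge_induct)
  case (step j)
  then show ?case using assms(1)[of j] by (auto simp: chain_comp_step)
qed (use assms(2) in simp)

text \<open>The tail of the end above \<open>i\<close> is forced; below \<open>i\<close>, surjectivity allows preimages to be chosen
  one after the other.\<close>

lemma end_space_through:
  assumes surj: "\<And>k. \<Phi> k ` X k = X (k + 1)" and a: "a \<in> X i"
  shows "\<exists>x \<in> end_space X \<Phi>. x i = a"
proof -
  have "\<exists>s. \<forall>n. (s n \<in> X (i - int n) \<and> (n = 0 \<longrightarrow> s n = a)) \<and>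
      \<Phi> (i - int (Suc n)) (s (Suc n)) = s n"
  proof (rule dependent_nat_choice)
    fix b n assume "b \<in> X (i - int n) \<and> (n = 0 \<longrightarrow> b = a)"
    then have "b \<in> \<Phi> (i - int (Suc n)) ` X (i - int (Suc n))"
      using surj[of "i - int (Suc n)"] by simp
    then show "\<exists>c. (c \<in> X (i - int (Suc n)) \<and> (Suc n = 0 \<longrightarrow> c = a)) \<and>
        \<Phi> (i - int (Suc n)) c = b" by auto
  qed (use a in simp)
  \<comment> \<open>\<open>s n\<close> is the coordinate at level \<open>i - n\<close>.\<close>
  then obtain s where s: "\<And>n. s n \<in> X (i - int n)" "s 0 = a"
    "\<And>n. \<Phi> (i - int (Suc n)) (s (Suc n)) = s n" by metis
  define x where "x j = (if i \<le> j then chain_comp \<Phi> i j a else s (nat (i - j)))" for j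
  have xi: "x i = a" by (simp add: x_def)
  have "x j \<in> X j" for j
    using s(1)[of "nat (i - j)"] a surj by (auto simp: x_def intro!: chain_comp_in)
  moreover have "\<Phi> j (x j) = x (j + 1)" for j
  proof (cases "i \<le> j")
    case False
    then obtain n where n: "j = i - int (Suc n)"
      using zero_less_imp_eq_int[of "i - j"] by (metis Suc_pred diff_diff_eq2 diff_add_cancel
          add_diff_cancel_left' not_le diff_gt_0_iff_gt)
    have "x (j + 1) = s n" using n s(2) by (cases n) (auto simp: x_def nat_add_distrib)
    moreover have "x j = s (Suc n)" using n by (simp add: x_def nat_add_distrib)
    ultimately show ?thesis using s(3)[of n] n by simp
  qed (simp add: x_def chain_comp_step)
  ultimately show ?thesis using xi by (auto simp: end_space_def)
qed

lemma end_space_image: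
  assumes "D_chain X \<Phi>"
  shows "(\<lambda>x. x i) ` end_space X \<Phi> = X i"
proof
  show "X i \<subseteq> (\<lambda>x. x i) ` end_space X \<Phi>"
    using assms end_space_through[of \<Phi> X] by (fastforce simp: D_chain_def)
qed (auto simp: end_space_def)

lemma end_space_nonempty:
  assumes "D_chain X \<Phi>"
  shows "end_space X \<Phi> \<noteq> {}"
proof
  assume "end_space X \<Phi> = {}"
  then have "X i = {}" for i using end_space_image[OF assms, of i] by simp
  then have "direct_limit X \<Phi> = {}" by (simp add: direct_limit_def quotient_def)
  then show False using assms by (simp add: D_chain_def is_singleton_def)
qed

lemma end_space_eqI:
  assumes "x \<in> end_space X \<Phi>" "y \<in> end_space X \<Phi>" "\<And>i. \<exists>j \<le> i. x j = y j"
  shows "x = y"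
  using assms by (metis end_space_chain_comp ext)

section \<open>Strictly increasing integer sequences\<close>

lemma strict_mono_int_iff_step:
  fixes \<gamma> :: "int \<Rightarrow> int"
  shows "strict_mono \<gamma> \<longleftrightarrow> (\<forall>n. \<gamma> n < \<gamma> (n + 1))"
proof
  assume step: "\<forall>n. \<gamma> n < \<gamma> (n + 1)"
  show "strict_mono \<gamma>"
  proof (rule strict_monoI)
    fix m n :: int assume "m < n"
    then show "\<gamma> m < \<gamma> n"
    proof (induction n rule: int_gr_induct)
      case (step n)
      then show ?case using \<open>\<forall>n. \<gamma> n < \<gamma> (n + 1)\<close> by (meson less_trans)
    qed (use step in simp)
  qed
qed (simp add: strict_monoD)

lemma strict_mono_int_growth:
  fixes \<alpha> :: "int \<Rightarrow> int"
  assumes "strict_mono \<alpha>" "i \<le> j"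
  shows "\<alpha> i + (j - i) \<le> \<alpha> j"
  using assms(2)
proof (induction j rule: int_ge_induct)
  case (step j)
  then show ?case using strict_monoD[OF assms(1), of j "j + 1"] by simp
qed simp

lemma strict_mono_int_unbounded:
  fixes \<alpha> :: "int \<Rightarrow> int"
  assumes "strict_mono \<alpha>"
  shows "\<exists>k. i \<le> \<alpha> k" "\<exists>k. \<alpha> k \<le> i"
proof -
  have "i \<le> \<alpha> \<bar>i - \<alpha> 0\<bar>" using strict_mono_int_growth[OF assms, of 0 "\<bar>i - \<alpha> 0\<bar>"] by simp
  then show "\<exists>k. i \<le> \<alpha> k" ..
  have "\<alpha> (- \<bar>i - \<alpha> 0\<bar>) \<le> i"
    using strict_mono_int_growth[OF assms, of "- \<bar>i - \<alpha> 0\<bar>" 0] by simp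
  then show "\<exists>k. \<alpha> k \<le> i" ..
qed

text \<open>Dependent choice in both directions: iterate a successor function to the right and a predecessor
  function to the left of an arbitrary starting point.\<close>

lemma bi_infinite_choice:
  assumes "\<And>a. \<exists>b. R a b" "\<And>b. \<exists>a. R a b"
  shows "\<exists>\<gamma> :: int \<Rightarrow> 'a. \<forall>n. R (\<gamma> n) (\<gamma> (n + 1))"
proof -
  obtain u d where u: "\<And>a. R a (u a)" and d: "\<And>b. R (d b) b"
    using assms by metis
  define \<gamma> where "\<gamma> n = (if 0 \<le> n then (u ^^ nat n) undefined else (d ^^ nat (- n)) undefined)"
    for n :: int
  have "R (\<gamma> n) (\<gamma> (n + 1))" for n
  proof (cases "0 \<le> n")
    case True
    then show ?thesis using u by (simp add: \<gamma>_def nat_add_distrib)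
  next
    case False
    define m where "m = nat (- (n + 1))"
    have "nat (- n) = Suc m" using False by (simp add: m_def)
    then have "\<gamma> n = d ((d ^^ m) undefined)" using False by (simp add: \<gamma>_def)
    moreover have "\<gamma> (n + 1) = (d ^^ m) undefined"
      using False by (cases "n = - 1") (auto simp: \<gamma>_def m_def)
    ultimately show ?thesis using d by simp
  qed
  then show ?thesis by blast
qed

section \<open>From a zig-zag chain to an equivalence\<close>

text \<open>A coherent family along a subchain determines every coordinate \<open>j\<close>: push \<open>w k\<close> forward from
  any \<open>\<alpha> k \<le> j\<close>.  Such \<open>k\<close> exist because \<open>\<alpha>\<close> is unbounded below, and coherence makes the result
  independent of \<open>k\<close>.\<close>

lemma end_space_through_cofinal:
  assumes into: "\<And>k. \<Phi> k ` X k \<subseteq> X (k + 1)" and \<alpha>: "strict_mono \<alpha>"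
    and w: "\<And>k. w k \<in> X (\<alpha> k)" "\<And>k. subchain_maps \<alpha> \<Phi> k (w k) = w (k + 1)"
  shows "\<exists>x \<in> end_space X \<Phi>. \<forall>k. x (\<alpha> k) = w k"
proof -
  have le: "\<alpha> k \<le> \<alpha> l \<longleftrightarrow> k \<le> l" for k l using \<alpha> by (rule strict_mono_less_eq)
  have trace: "chain_comp \<Phi> (\<alpha> k) (\<alpha> l) (w k) = w l" if "k \<le> l" for k l
    using that
  proof (induction l rule: int_ge_induct)
    case (step l)
    then show ?case
      using w(2)[of l] chain_comp_trans[of "\<alpha> k" "\<alpha> l" "\<alpha> (l + 1)" \<Phi> "w k"]
      by (simp add: subchain_maps_def le)
  qed simp
  obtain \<kappa> where \<kappa>: "\<And>j. \<alpha> (\<kappa> j) \<le> j" using strict_mono_int_unbounded(2)[OF \<alpha>] by metis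
  define x where "x j = chain_comp \<Phi> (\<alpha> (\<kappa> j)) j (w (\<kappa> j))" for j
  have later: "chain_comp \<Phi> (\<alpha> k) j (w k) = chain_comp \<Phi> (\<alpha> l) j (w l)"
    if "k \<le> l" "\<alpha> l \<le> j" for k l j
    using that chain_comp_trans[of "\<alpha> k" "\<alpha> l" j \<Phi> "w k"] by (simp add: le trace)
  have x: "x j = chain_comp \<Phi> (\<alpha> k) j (w k)" if "\<alpha> k \<le> j" for j k
  proof (cases "k \<le> \<kappa> j")
    case True
    then show ?thesis using later \<kappa> by (simp add: x_def)
  next
    case False
    then show ?thesis using later[of "\<kappa> j" k j] that by (simp add: x_def)
  qed
  have "x j \<in> X j" for j
    unfolding x_def using into w(1) \<kappa> by (intro chain_comp_in) auto
  moreover have "\<Phi> j (x j) = x (j + 1)" for j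
    using x[of "\<kappa> j" "j + 1"] x[of "\<kappa> j" j] \<kappa>[of j] by (simp add: chain_comp_step)
  ultimately have "x \<in> end_space X \<Phi>" by (simp add: end_space_def)
  moreover have "x (\<alpha> k) = w k" for k using x[of k "\<alpha> k"] by simp
  ultimately show ?thesis by blast
qed

text \<open>A ladder of maps between two subchains acts on threads, hence on ends.\<close>

lemma ex_end_map:
  assumes \<alpha>: "strict_mono \<alpha>" and \<beta>: "strict_mono \<beta>" and Y: "D_chain Y \<Psi>"
    and u: "\<And>k a. a \<in> X (\<alpha> k) \<Longrightarrow> u k a \<in> Y (\<beta> k)"
      "\<And>k a. a \<in> X (\<alpha> k) \<Longrightarrow>
         subchain_maps \<beta> \<Psi> k (u k a) = u (k + 1) (subchain_maps \<alpha> \<Phi> k a)"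
  shows "\<exists>f \<in> end_space X \<Phi> \<rightarrow> end_space Y \<Psi>.
           \<forall>x \<in> end_space X \<Phi>. \<forall>k. f x (\<beta> k) = u k (x (\<alpha> k))"
proof -
  have "\<exists>y. y \<in> end_space Y \<Psi> \<and> (\<forall>k. y (\<beta> k) = u k (x (\<alpha> k)))" if x: "x \<in> end_space X \<Phi>" for x
  proof -
    have "subchain_maps \<alpha> \<Phi> k (x (\<alpha> k)) = x (\<alpha> (k + 1))" for k
      using x strict_monoD[OF \<alpha>, of k "k + 1"]
      by (simp add: subchain_maps_def end_space_chain_comp)
    moreover have "x (\<alpha> k) \<in> X (\<alpha> k)" for k using x by (simp add: end_space_def)
    ultimately show ?thesis
      using end_space_through_cofinal[OF _ \<beta>, of \<Psi> Y "\<lambda>k. u k (x (\<alpha> k))"] Y u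
      by (fastforce simp: D_chain_def)
  qed
  then obtain f where "\<And>x. x \<in> end_space X \<Phi> \<Longrightarrow>
      f x \<in> end_space Y \<Psi> \<and> (\<forall>k. f x (\<beta> k) = u k (x (\<alpha> k)))" by metis
  then show ?thesis by blast
qed

lemma all_scale_uniform_end_if_cofinal_control:
  fixes \<alpha> \<beta> :: "int \<Rightarrow> int"
  assumes X: "D_chain X \<Phi>" and Y: "D_chain Y \<Psi>" and \<alpha>: "strict_mono \<alpha>" and \<beta>: "strict_mono \<beta>"
    and f: "f \<in> end_space X \<Phi> \<rightarrow> end_space Y \<Psi>"
    and lc: "\<And>k. level_control (end_space X \<Phi>) f (\<alpha> k) (\<beta> k)"
  shows "all_scale_uniform (end_metric X \<Phi>) (end_metric Y \<Psi>) f"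
proof -
  have "\<exists>j. level_control (end_space X \<Phi>) f i j" for i
    using strict_mono_int_unbounded(1)[OF \<alpha>, of i] level_control_mono[OF lc f] by blast
  moreover have "\<exists>i. level_control (end_space X \<Phi>) f i j" for j
    using strict_mono_int_unbounded(2)[OF \<beta>, of j] level_control_mono[OF lc f] by blast
  ultimately show ?thesis using f by (simp add: all_scale_uniform_end_iff[OF X Y])
qed

lemma equivalent_if_common_zigzag:
  assumes X: "D_chain X \<Phi>" and Y: "D_chain Y \<Psi>" and zz: "common_zigzag_D_chain X \<Phi> Y \<Psi> Z V"
  shows "all_scale_uniform_equivalent (end_metric X \<Phi>) (end_metric Y \<Psi>)"
proof -
  let ?E = "end_space X \<Phi>" and ?F = "end_space Y \<Psi>"
  obtain \<alpha> \<beta> where \<alpha>: "strict_mono \<alpha>" and \<beta>: "strict_mono \<beta>"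
    and Zodd: "\<And>k. Z (2 * k - 1) = Inl ` X (\<alpha> k)" and Zeven: "\<And>k. Z (2 * k) = Inr ` Y (\<beta> k)"
    and Vodd: "\<And>k a. a \<in> X (\<alpha> k) \<Longrightarrow>
      V (2 * k) (V (2 * k - 1) (Inl a)) = Inl (subchain_maps \<alpha> \<Phi> k a)"
    and Veven: "\<And>k b. b \<in> Y (\<beta> k) \<Longrightarrow>
      V (2 * k + 1) (V (2 * k) (Inr b)) = Inr (subchain_maps \<beta> \<Psi> k b)"
    using zz by (auto simp: common_zigzag_D_chain_def subchain_sets_def)
  have VZ: "V n ` Z n = Z (n + 1)" for n
    using zz by (auto simp: common_zigzag_D_chain_def D_chain_def)
  have \<alpha>': "strict_mono (\<lambda>k. \<alpha> (k + 1))" using \<alpha> by (simp add: strict_mono_def)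
  \<comment> \<open>The rungs of the zig-zag, freed from the injections into the sum type.\<close>
  define u where "u k a = projr (V (2 * k - 1) (Inl a))" for k a
  define v where "v k b = projl (V (2 * k) (Inr b))" for k b
  have u: "u k a \<in> Y (\<beta> k)" "V (2 * k - 1) (Inl a) = Inr (u k a)" if "a \<in> X (\<alpha> k)" for k a
  proof -
    have "V (2 * k - 1) (Inl a) \<in> Inr ` Y (\<beta> k)"
      using VZ[of "2 * k - 1"] that by (auto simp: Zodd Zeven)
    then show "u k a \<in> Y (\<beta> k)" "V (2 * k - 1) (Inl a) = Inr (u k a)" by (auto simp: u_def)
  qed
  have v: "v k b \<in> X (\<alpha> (k + 1))" "V (2 * k) (Inr b) = Inl (v k b)" if "b \<in> Y (\<beta> k)" for k b
  proof -
    have "V (2 * k) (Inr b) \<in> Inl ` X (\<alpha> (k + 1))"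
      using VZ[of "2 * k"] that Zodd[of "k + 1"]
      by (auto simp: Zeven add.commute)
    then show "v k b \<in> X (\<alpha> (k + 1))" "V (2 * k) (Inr b) = Inl (v k b)" by (auto simp: v_def)
  qed
  have vu: "v k (u k a) = subchain_maps \<alpha> \<Phi> k a" if "a \<in> X (\<alpha> k)" for k a
    using Vodd[OF that] u[OF that] v(2)[of "u k a" k] by simp
  have uv: "u (k + 1) (v k b) = subchain_maps \<beta> \<Psi> k b" if "b \<in> Y (\<beta> k)" for k b
    using Veven[OF that] v[OF that] u(2)[of "v k b" "k + 1"]
    by (simp add: add.commute)
  have subX: "subchain_maps \<alpha> \<Phi> k (x (\<alpha> k)) = x (\<alpha> (k + 1))" if "x \<in> ?E" for x k
    using that strict_monoD[OF \<alpha>, of k "k + 1"] by (simp add: subchain_maps_def end_space_chain_comp)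
  have subY: "subchain_maps \<beta> \<Psi> k (y (\<beta> k)) = y (\<beta> (k + 1))" if "y \<in> ?F" for y k
    using that strict_monoD[OF \<beta>, of k "k + 1"] by (simp add: subchain_maps_def end_space_chain_comp)
  have inX: "x i \<in> X i" if "x \<in> ?E" for x i using that by (simp add: end_space_def)
  have inY: "y i \<in> Y i" if "y \<in> ?F" for y i using that by (simp add: end_space_def)

  obtain f where f: "f \<in> ?E \<rightarrow> ?F" and fu: "\<And>x k. x \<in> ?E \<Longrightarrow> f x (\<beta> k) = u k (x (\<alpha> k))"
    using ex_end_map[OF \<alpha> \<beta> Y, of X u \<Phi>] u vu uv by metis
  have "subchain_maps (\<lambda>k. \<alpha> (k + 1)) \<Phi> k (v k b) = v (k + 1) (subchain_maps \<beta> \<Psi> k b)"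
    if "b \<in> Y (\<beta> k)" for k b
    using vu[OF v(1)[OF that]] uv[OF that] by (simp add: subchain_maps_def)
  then obtain g where g: "g \<in> ?F \<rightarrow> ?E"
    and gv: "\<And>y k. y \<in> ?F \<Longrightarrow> g y (\<alpha> (k + 1)) = v k (y (\<beta> k))"
    using ex_end_map[OF \<beta> \<alpha>' X, of Y v \<Psi>] v by metis

  have gf: "g (f x) = x" if x: "x \<in> ?E" for x
  proof (rule end_space_eqI)
    have "g (f x) (\<alpha> (k + 1)) = x (\<alpha> (k + 1))" for k
      using f x gv[of "f x" k] fu[OF x, of k] vu[OF inX[OF x], of k] subX[OF x, of k] by auto
    then show "\<exists>j \<le> i. g (f x) j = x j" for i
      using strict_mono_int_unbounded(2)[OF \<alpha>', of i] by blast
  qed (use f g x in auto)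
  have fg: "f (g y) = y" if y: "y \<in> ?F" for y
  proof (rule end_space_eqI)
    have "f (g y) (\<beta> (k + 1)) = y (\<beta> (k + 1))" for k
      using g y fu[of "g y" "k + 1"] gv[OF y, of k] uv[OF inY[OF y], of k] subY[OF y, of k] by auto
    moreover have "\<exists>k. \<beta> (k + 1) \<le> i" for i
      using strict_mono_int_unbounded(2)[OF \<beta>, of i] by (metis diff_add_cancel)
    ultimately show "\<exists>j \<le> i. f (g y) j = y j" for i by blast
  qed (use f g y in auto)

  have bij: "bij_betw f ?E ?F"
    using f g gf fg by (intro bij_betw_byWitness[of _ g]) auto
  have inv: "inv_into ?E f y = g y" if "y \<in> ?F" for y
    using that f g fg bij by (intro inv_into_f_eq) (auto simp: bij_betw_def)
  have "all_scale_uniform (end_metric X \<Phi>) (end_metric Y \<Psi>) f"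
    by (rule all_scale_uniform_end_if_cofinal_control[OF X Y \<alpha> \<beta> f])
      (auto simp: level_control_def fu)
  moreover have "all_scale_uniform (end_metric Y \<Psi>) (end_metric X \<Phi>) (inv_into ?E f)"
    by (rule all_scale_uniform_end_if_cofinal_control[OF Y X \<beta> \<alpha>'])
      (use g in \<open>auto simp: level_control_def inv gv\<close>)
  ultimately show ?thesis
    using bij unfolding all_scale_uniform_equivalent_def
    by (auto simp: end_metric_simps[OF X] end_metric_simps[OF Y])
qed

section \<open>From an equivalence to a zig-zag chain\<close>

text \<open>The elements \<open>t n x\<close> for fixed \<open>x\<close> form a thread of the chain, and threads that meet once agree
  from then on.  So if any two threads of a family meet, and the family passes through every
  element, then all elements are identified in the direct limit.\<close>

lemma D_chain_of_traces:
  assumes ne: "E \<noteq> {}" and Z: "\<And>n. Z n = t n ` E"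
    and V: "\<And>n x. x \<in> E \<Longrightarrow> V n (t n x) = t (n + 1) x"
    and merge: "\<And>x y. x \<in> E \<Longrightarrow> y \<in> E \<Longrightarrow> \<exists>n. t n x = t n y"
  shows "D_chain Z V"
proof -
  have comp: "chain_comp V i j (t i x) = t j x" if "x \<in> E" "i \<le> j" for i j x
    using that(2)
  proof (induction j rule: int_ge_induct)
    case (step j)
    then show ?case using V that(1) by (simp add: chain_comp_step)
  qed simp
  have "((i, t i x), (j, t j y)) \<in> direct_limit_rel Z V" if xy: "x \<in> E" "y \<in> E" for i j x y
  proof -
    obtain n where "t n x = t n y" using merge[OF xy] ..
    define k where "k = max n (max i j)"
    have "t k x = t k y"
      using comp[OF xy(1), of n k] comp[OF xy(2), of n k] \<open>t n x = t n y\<close> by (simp add: k_def)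
    then have "chain_comp V i k (t i x) = chain_comp V j k (t j y)"
      using comp xy by (simp add: k_def)
    then show ?thesis using xy
      by (auto simp: direct_limit_rel_def Z k_def intro!: exI[of _ k])
  qed
  then have "direct_limit_rel Z V `` {p} = Sigma UNIV Z" if "p \<in> Sigma UNIV Z" for p
    using that by (auto simp: Z direct_limit_rel_def)
  moreover have "Sigma UNIV Z \<noteq> {}" using ne by (simp add: Z Sigma_empty_iff)
  ultimately have "direct_limit Z V = {Sigma UNIV Z}"
    by (auto simp: direct_limit_def quotient_def)
  moreover have "V n ` Z n = Z (n + 1)" for n by (auto simp: Z V image_image)
  ultimately show ?thesis by (simp add: D_chain_def)
qed

text \<open>Control persists when the source level is lowered or the target level raised.  Hence maxima and
  minima of levels give a common level for both maps, and it can be taken strictly above or below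
  the given one, which makes \<open>\<gamma>\<close> strictly increasing.\<close>

lemma ex_interleaved_control:
  assumes X: "D_chain X \<Phi>" and Y: "D_chain Y \<Psi>"
    and f: "all_scale_uniform (end_metric X \<Phi>) (end_metric Y \<Psi>) f"
    and g: "all_scale_uniform (end_metric Y \<Psi>) (end_metric X \<Phi>) g"
  shows "\<exists>\<gamma> :: int \<Rightarrow> int. strict_mono \<gamma> \<and> (\<forall>n. level_control (end_space X \<Phi>) f (\<gamma> n) (\<gamma> (n + 1)) \<and>
           level_control (end_space Y \<Psi>) g (\<gamma> n) (\<gamma> (n + 1)))"
proof -
  let ?F = "level_control (end_space X \<Phi>) f" and ?G = "level_control (end_space Y \<Psi>) g"
  define R where "R i j \<longleftrightarrow> i < j \<and> ?F i j \<and> ?G i j" for i j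
  note f = f[unfolded all_scale_uniform_end_iff[OF X Y]]
  note g = g[unfolded all_scale_uniform_end_iff[OF Y X]]
  have F: "?F i' j'" if "?F i j" "i' \<le> i" "j \<le> j'" for i j i' j'
    using level_control_mono[OF that(1) _ that(2,3)] f by blast
  have G: "?G i' j'" if "?G i j" "i' \<le> i" "j \<le> j'" for i j i' j'
    using level_control_mono[OF that(1) _ that(2,3)] g by blast
  have "\<exists>j. R i j" for i
  proof -
    obtain j1 j2 where "?F i j1" "?G i j2" using f g by blast
    then have "R i (max (i + 1) (max j1 j2))" unfolding R_def by (auto intro: F G)
    then show ?thesis ..
  qed
  moreover have "\<exists>i. R i j" for j
  proof -
    obtain i1 i2 where "?F i1 j" "?G i2 j" using f g by blast
    then have "R (min (j - 1) (min i1 i2)) j" unfolding R_def by (auto intro: F G)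
    then show ?thesis ..
  qed
  ultimately obtain \<gamma> :: "int \<Rightarrow> int" where "\<And>n. R (\<gamma> n) (\<gamma> (n + 1))"
    using bi_infinite_choice[of R] by blast
  then show ?thesis by (auto simp: R_def strict_mono_int_iff_step)
qed

lemma common_zigzag_if_equivalent:
  assumes X: "D_chain X \<Phi>" and Y: "D_chain Y \<Psi>"
    and "all_scale_uniform_equivalent (end_metric X \<Phi>) (end_metric Y \<Psi>)"
  shows "\<exists>Z V. common_zigzag_D_chain X \<Phi> Y \<Psi> Z V"
proof -
  let ?E = "end_space X \<Phi>" and ?F = "end_space Y \<Psi>"
  obtain f where bij: "bij_betw f ?E ?F"
    and asu: "all_scale_uniform (end_metric X \<Phi>) (end_metric Y \<Psi>) f"
      "all_scale_uniform (end_metric Y \<Psi>) (end_metric X \<Phi>) (inv_into ?E f)"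
    using assms(3) by (auto simp: all_scale_uniform_equivalent_def end_metric_simps[OF X]
        end_metric_simps[OF Y])
  obtain \<gamma> :: "int \<Rightarrow> int" where \<gamma>: "strict_mono \<gamma>"
    and F: "\<And>n. level_control ?E f (\<gamma> n) (\<gamma> (n + 1))"
    and G: "\<And>n. level_control ?F (inv_into ?E f) (\<gamma> n) (\<gamma> (n + 1))"
    using ex_interleaved_control[OF X Y asu] by blast
  have fF: "f x \<in> ?F" and inv: "inv_into ?E f (f x) = x" if "x \<in> ?E" for x
    using that bij bij_betw_inv_into_left[OF bij] by (auto simp: bij_betw_def)
  have Y_image: "Y i = (\<lambda>x. f x i) ` ?E" for i
  proof -
    have "Y i = (\<lambda>y. y i) ` f ` ?E"
      using end_space_image[OF Y, of i] bij_betw_imp_surj_on[OF bij] by simp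
    then show ?thesis by (simp only: image_image)
  qed
  define t where "t n x = (if odd n then Inl (x (\<gamma> n)) else Inr (f x (\<gamma> n)))" for n x
  have next_eq: "t (n + 1) x = t (n + 1) y" if "x \<in> ?E" "y \<in> ?E" "t n x = t n y" for n x y
  proof (cases "odd n")
    case True
    then have "x (\<gamma> n) = y (\<gamma> n)" using that by (simp add: t_def)
    then have "f x (\<gamma> (n + 1)) = f y (\<gamma> (n + 1))"
      using F[of n] that unfolding level_control_def by blast
    then show ?thesis using True by (simp add: t_def)
  next
    case False
    then have "f x (\<gamma> n) = f y (\<gamma> n)" using that by (simp add: t_def)
    then have "inv_into ?E f (f x) (\<gamma> (n + 1)) = inv_into ?E f (f y) (\<gamma> (n + 1))"
      using G[of n] fF that unfolding level_control_def by blast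
    then show ?thesis using False that inv by (simp add: t_def)
  qed
  define Z where "Z n = t n ` ?E" for n
  \<comment> \<open>By \<open>next_eq\<close> the choice of the end \<open>x\<close> through \<open>z\<close> does not matter.\<close>
  define V where "V n z = t (n + 1) (SOME x. x \<in> ?E \<and> t n x = z)" for n z
  have V: "V n (t n x) = t (n + 1) x" if "x \<in> ?E" for n x
    unfolding V_def by (rule someI2[of _ x]) (use that next_eq in blast)+
  have DZ: "D_chain Z V"
  proof (rule D_chain_of_traces[where E = ?E and t = t, OF end_space_nonempty[OF X] Z_def V])
    fix x y assume xy: "x \<in> ?E" "y \<in> ?E"
    obtain i where i: "x i = y i"
      using D_chain_merge[OF X, of "x 0" 0 "y 0" 0] xy
      by (metis (mono_tags, lifting) end_space_chain_comp end_space_def less_imp_le mem_Collect_eq)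
    \<comment> \<open>Two ends of \<open>X\<close> agree from some level on, hence at a late odd stage.\<close>
    have "strict_mono (\<lambda>k. \<gamma> (2 * k - 1))" using \<gamma> by (simp add: strict_mono_def)
    then obtain k where "i \<le> \<gamma> (2 * k - 1)"
      using strict_mono_int_unbounded(1)[of "\<lambda>k. \<gamma> (2 * k - 1)" i] by blast
    then have "x (\<gamma> (2 * k - 1)) = y (\<gamma> (2 * k - 1))"
      using i xy by (metis end_space_chain_comp)
    then have "t (2 * k - 1) x = t (2 * k - 1) y" by (simp add: t_def)
    then show "\<exists>n. t n x = t n y" ..
  qed
  have Zodd: "Z (2 * k - 1) = Inl ` X (\<gamma> (2 * k - 1))" for k
    using arg_cong[OF end_space_image[OF X, of "\<gamma> (2 * k - 1)"], of "image Inl"]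
    by (simp add: Z_def t_def image_image)
  have Zeven: "Z (2 * k) = Inr ` Y (\<gamma> (2 * k))" for k
    unfolding Y_image by (simp add: Z_def t_def image_image)
  have Vodd: "V (2 * k) (V (2 * k - 1) (Inl a)) =
      Inl (chain_comp \<Phi> (\<gamma> (2 * k - 1)) (\<gamma> (2 * (k + 1) - 1)) a)"
    if "a \<in> X (\<gamma> (2 * k - 1))" for k a
  proof -
    have "a \<in> (\<lambda>x. x (\<gamma> (2 * k - 1))) ` ?E" using that by (simp add: end_space_image[OF X])
    then obtain x where x: "x \<in> ?E" "a = x (\<gamma> (2 * k - 1))" by blast
    have "Inl a = t (2 * k - 1) x" using x by (simp add: t_def)
    then have "V (2 * k) (V (2 * k - 1) (Inl a)) = t (2 * k + 1) x"
      using V[OF x(1), of "2 * k - 1"] V[OF x(1), of "2 * k"] by simp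
    then show ?thesis
      using x strict_mono_less_eq[OF \<gamma>] by (simp add: t_def end_space_chain_comp add.commute)
  qed
  have Veven: "V (2 * k + 1) (V (2 * k) (Inr b)) =
      Inr (chain_comp \<Psi> (\<gamma> (2 * k)) (\<gamma> (2 * (k + 1))) b)"
    if "b \<in> Y (\<gamma> (2 * k))" for k b
  proof -
    have "b \<in> (\<lambda>x. f x (\<gamma> (2 * k))) ` ?E" using that by (simp add: Y_image)
    then obtain x where x: "x \<in> ?E" "b = f x (\<gamma> (2 * k))" by blast
    have "Inr b = t (2 * k) x" using x by (simp add: t_def)
    then have "V (2 * k + 1) (V (2 * k) (Inr b)) = t (2 * k + 2) x"
      using V[OF x(1), of "2 * k"] V[OF x(1), of "2 * k + 1"]
      by (simp add: add.commute)
    then show ?thesis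
      using x strict_mono_less_eq[OF \<gamma>]
      by (simp add: t_def end_space_chain_comp[OF fF[OF x(1)]] add.commute)
  qed
  have mono: "strict_mono (\<lambda>k. \<gamma> (2 * k - 1))" "strict_mono (\<lambda>k. \<gamma> (2 * k))"
    using \<gamma> by (simp_all add: strict_mono_def)
  have "common_zigzag_D_chain X \<Phi> Y \<Psi> Z V"
    unfolding common_zigzag_D_chain_def subchain_sets_def subchain_maps_def
    by (rule conjI[OF DZ], rule exI[of _ "\<lambda>k. \<gamma> (2 * k - 1)"],
        rule exI[of _ "\<lambda>k. \<gamma> (2 * k)"], intro conjI allI ballI)
      (rule mono Zodd Zeven Vodd Veven, assumption?)+
  then show ?thesis by blast
qed

theorem proposition3p8:
  fixes X :: "int \<Rightarrow> 'a set" and \<Phi> :: "int \<Rightarrow> 'a \<Rightarrow> 'a"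
    and Y :: "int \<Rightarrow> 'b set" and \<Psi> :: "int \<Rightarrow> 'b \<Rightarrow> 'b"
  assumes "D_chain X \<Phi>" and "D_chain Y \<Psi>"
  shows "(\<exists>Z V. common_zigzag_D_chain X \<Phi> Y \<Psi> Z V) \<longleftrightarrow>
         all_scale_uniform_equivalent (end_metric X \<Phi>) (end_metric Y \<Psi>)"
  using equivalent_if_common_zigzag[OF assms] common_zigzag_if_equivalent[OF assms] by blast

end
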